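(* Geometric multiplication of real numbers is commutative: for all real numbers $a$ and $b$, $ab=ba$.
   Context: Work in the Euclidean plane (with Euclid's/Hilbert's axioms of plane geometry) with perpendicular $x$- and $y$-axes meeting at the origin $(0,0)$ and a common unit length on both axes. A line is regarded as parallel to itself. Geometric product: for real numbers $a$ and $b$, lay $a$ along the $y$-axis and $b$ along the $x$-axis; $ab$ ("$a$ multiplied by $b$") is defined to be the $x$-intercept of the line through the point $(0,a)$ that is parallel to the segment joining $(b,0)$ and $(0,1)$. Every product in the claim is meant in this sense; no other notion of multiplication is presupposed. *)

theory Defs
  imports Complex_Main
begin

text \<open>
  Plane geometry after Hilbert, in the formulation of Hartshorne (Geometry: Euclid and Beyond,
  axioms I1-I3, B1-B4, C1-C6, P).  No coordinates and no arithmetic enter the plane itself.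
  A line is the set of its points, a segment is the unordered pair of its end points, and
  an angle is the unordered pair of its sides, which are rays with a common origin.
\<close>

locale plane_structure =
  fixes lines :: "'p set set"
    and btw :: "'p \<Rightarrow> 'p \<Rightarrow> 'p \<Rightarrow> bool"  \<comment> \<open>\<open>btw A B C\<close>: \<open>B\<close> lies strictly between \<open>A\<close> and \<open>C\<close>\<close>
    and scong :: "'p set \<Rightarrow> 'p set \<Rightarrow> bool"  \<comment> \<open>congruence of segments\<close>
    and acong :: "'p set set \<Rightarrow> 'p set set \<Rightarrow> bool"  \<comment> \<open>congruence of angles\<close>
begin

definition collin :: "'p \<Rightarrow> 'p \<Rightarrow> 'p \<Rightarrow> bool" where
  "collin A B C \<longleftrightarrow> (\<exists>l\<in>lines. A \<in> l \<and> B \<in> l \<and> C \<in> l)"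

definition line :: "'p \<Rightarrow> 'p \<Rightarrow> 'p set" where
  "line A B = (THE l. l \<in> lines \<and> A \<in> l \<and> B \<in> l)"

definition parallel :: "'p set \<Rightarrow> 'p set \<Rightarrow> bool" where
  "parallel l m \<longleftrightarrow> l \<in> lines \<and> m \<in> lines \<and> (l = m \<or> l \<inter> m = {})"

definition same_side :: "'p set \<Rightarrow> 'p \<Rightarrow> 'p \<Rightarrow> bool" where
  "same_side l A B \<longleftrightarrow> A \<notin> l \<and> B \<notin> l \<and> \<not> (\<exists>C\<in>l. btw A C B)"

text \<open>The ray from \<open>A\<close> through \<open>B\<close>, without its origin \<open>A\<close>.\<close>

definition ray :: "'p \<Rightarrow> 'p \<Rightarrow> 'p set" where
  "ray A B = {C. C = B \<or> btw A C B \<or> btw A B C}"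

definition segments :: "'p set set" where
  "segments = {{A, B} | A B. A \<noteq> B}"

definition angle :: "'p \<Rightarrow> 'p \<Rightarrow> 'p \<Rightarrow> 'p set set" where
  "angle A B C = {ray B A, ray B C}"

definition angles :: "'p set set set" where
  "angles = {angle A B C | A B C. \<not> collin A B C}"

text \<open>Right angles are the angles congruent to a supplementary angle.\<close>

definition perpendicular :: "'p set \<Rightarrow> 'p set \<Rightarrow> bool" where
  "perpendicular l m \<longleftrightarrow> l \<in> lines \<and> m \<in> lines \<and>
    (\<exists>Q A A' B. Q \<in> l \<inter> m \<and> A \<in> l \<and> A' \<in> l \<and> btw A Q A' \<and> B \<in> m \<and> B \<notin> l \<and>
       acong (angle A Q B) (angle A' Q B))"

end

locale euclidean_plane = plane_structure lines btw scong acong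
  for lines :: "'p set set" and btw and scong and acong +
  assumes I1: "A \<noteq> B \<Longrightarrow> \<exists>!l. l \<in> lines \<and> A \<in> l \<and> B \<in> l"
    and I2: "l \<in> lines \<Longrightarrow> \<exists>A\<in>l. \<exists>B\<in>l. A \<noteq> B"
    and I3: "\<exists>A B C. \<not> collin A B C"
    and B1: "btw A B C \<Longrightarrow>
      A \<noteq> B \<and> B \<noteq> C \<and> A \<noteq> C \<and> collin A B C \<and> btw C B A"
    and B2: "A \<noteq> B \<Longrightarrow> \<exists>C. btw A B C"
    and B3: "A \<noteq> B \<Longrightarrow> B \<noteq> C \<Longrightarrow> A \<noteq> C \<Longrightarrow> collin A B C \<Longrightarrow>
      (btw A B C \<and> \<not> btw B A C \<and> \<not> btw A C B) \<or>
      (\<not> btw A B C \<and> btw B A C \<and> \<not> btw A C B) \<or>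
      (\<not> btw A B C \<and> \<not> btw B A C \<and> btw A C B)"
    and B4: "\<not> collin A B C \<Longrightarrow> l \<in> lines \<Longrightarrow> A \<notin> l \<Longrightarrow> B \<notin> l \<Longrightarrow> C \<notin> l \<Longrightarrow>
      D \<in> l \<Longrightarrow> btw A D B \<Longrightarrow>
      (\<exists>E\<in>l. btw A E C) \<noteq> (\<exists>E\<in>l. btw B E C)"
    and C1: "S \<in> segments \<Longrightarrow> A \<noteq> B \<Longrightarrow> \<exists>!C. C \<in> ray A B \<and> scong S {A, C}"
    and C2_refl: "S \<in> segments \<Longrightarrow> scong S S"
    and C2: "S \<in> segments \<Longrightarrow> T \<in> segments \<Longrightarrow> U \<in> segments \<Longrightarrow>
      scong S T \<Longrightarrow> scong S U \<Longrightarrow> scong T U"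
    and C3: "btw A B C \<Longrightarrow> btw D E F \<Longrightarrow> scong {A, B} {D, E} \<Longrightarrow> scong {B, C} {E, F} \<Longrightarrow>
      scong {A, C} {D, F}"
    and C4: "\<alpha> \<in> angles \<Longrightarrow> A \<noteq> B \<Longrightarrow> Q \<notin> line A B \<Longrightarrow>
      \<exists>!r. \<exists>C. same_side (line A B) Q C \<and> r = ray A C \<and> acong \<alpha> (angle B A C)"
    and C5_refl: "\<alpha> \<in> angles \<Longrightarrow> acong \<alpha> \<alpha>"
    and C5: "\<alpha> \<in> angles \<Longrightarrow> \<beta> \<in> angles \<Longrightarrow> \<gamma> \<in> angles \<Longrightarrow>
      acong \<alpha> \<beta> \<Longrightarrow> acong \<alpha> \<gamma> \<Longrightarrow> acong \<beta> \<gamma>"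
    and C6: "\<not> collin A B C \<Longrightarrow> \<not> collin D E F \<Longrightarrow>
      scong {A, B} {D, E} \<Longrightarrow> scong {A, C} {D, F} \<Longrightarrow>
      acong (angle B A C) (angle E D F) \<Longrightarrow>
      scong {B, C} {E, F} \<and>
      acong (angle A B C) (angle D E F) \<and> acong (angle A C B) (angle D F E)"
    and P: "l \<in> lines \<Longrightarrow> parallel m l \<Longrightarrow> parallel n l \<Longrightarrow> A \<in> m \<Longrightarrow> A \<in> n \<Longrightarrow> m = n"

text \<open>
  A real scale on a line: a labelling of its points by all real numbers which matches
  betweenness with the order of the labels and congruence with equality of distances of labels.
  Only order, addition and absolute value of real numbers are used.  That such a
  labelling exists is what the continuity axioms (Archimedes, completeness) provide.
\<close>

definition (in plane_structure) real_scale :: "(real \<Rightarrow> 'p) \<Rightarrow> 'p set \<Rightarrow> bool" where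
  "real_scale s l \<longleftrightarrow> l \<in> lines \<and> bij_betw s UNIV l \<and>
    (\<forall>a b c. btw (s a) (s b) (s c) \<longleftrightarrow> (a < b \<and> b < c) \<or> (c < b \<and> b < a)) \<and>
    (\<forall>a b c d. a \<noteq> b \<longrightarrow> c \<noteq> d \<longrightarrow>
       (scong {s a, s b} {s c, s d} \<longleftrightarrow> \<bar>a - b\<bar> = \<bar>c - d\<bar>))"

text \<open>
  Perpendicular axes with common origin and common unit length; \<open>px a\<close> is the point
  $(a, 0)$ and \<open>py a\<close> is the point $(0, a)$.
\<close>

locale euclidean_plane_with_axes = euclidean_plane lines btw scong acong
  for lines :: "'p set set" and btw and scong and acong +
  fixes px py :: "real \<Rightarrow> 'p" and x_axis y_axis :: "'p set"
  assumes x_scale: "real_scale px x_axis"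
    and y_scale: "real_scale py y_axis"
    and axes_perpendicular: "perpendicular x_axis y_axis"
    and common_origin: "px 0 = py 0"
    and common_unit: "scong {px 0, px 1} {py 0, py 1}"
begin

definition parallel_through :: "'p \<Rightarrow> 'p set \<Rightarrow> 'p set" where
  "parallel_through A l = (THE m. A \<in> m \<and> parallel m l)"

definition x_intercept :: "'p set \<Rightarrow> real" where
  "x_intercept l = (THE c. px c \<in> l)"

text \<open>
  Total on all reals: the points \<open>px b\<close> and \<open>py 1\<close> are always distinct, and the line joining
  them meets the $x$-axis in one point only.
\<close>

definition geo_mult :: "real \<Rightarrow> real \<Rightarrow> real" where
  "geo_mult a b = x_intercept (parallel_through (py a) (line (px b) (py 1)))"

end

end

theory Submission
  imports Defs
begin

text \<open>
  Geometric multiplication agrees with the product of the field of real numbers, which is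
  commutative. If \<open>b = 0\<close>, the projecting line through \<open>(0, a)\<close> is the \<open>y\<close>-axis, and the product
  is \<open>0\<close>. Fix \<open>b \<noteq> 0\<close>. Then \<open>a \<mapsto> geo_mult a b\<close> is the parallel projection of the
  \<open>y\<close>-axis to the \<open>x\<close>-axis along the line from \<open>(b, 0)\<close> to \<open>(0, 1)\<close>, read off in the labels
  of the scales. It fixes the origin and sends \<open>1\<close> to \<open>b\<close>, so it is multiplication by \<open>b\<close> as
  soon as it is known to be linear over the reals.

  Linearity has two sources. The first is that a parallel projection preserves midpoints.
  Halving a distance from the origin is the midline theorem (\<open>triangle_midline\<close>), a change of sign
  is a point reflection in the origin (\<open>point_reflection\<close>), and the other midpoints come from the
  midline of a trapezoid (\<open>trapezoid_midline\<close>). Together they make the projection additive.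
  The second is order: by Pasch's axiom the projection preserves betweenness
  (\<open>geo_mult_btw\<close>), hence it maps the positive half of one axis to a single side of the
  origin on the other. An additive function of constant sign on the positive reals is linear
  (\<open>additive_nonneg_imp_linear\<close>).

  The theorems on midlines and point reflections are obtained from alternate angles: equal alternate
  angles give parallels, and by the parallel axiom the converse holds too. The
  required facts on angles (supplements, vertical angles) follow from the side-angle-side axiom,
  and those on sides of a line and on rays from Pasch's axiom.
\<close>

section \<open>Incidence\<close>

text \<open>
  The axioms also hold for a single point and no line, where \<open>collin A A A\<close> fails. One line
  is enough to exclude this plane, so that collinearity is trivial for repeated points.
\<close>

locale nondegenerate_plane = euclidean_plane lines btw scong acong
  for lines :: "'p set set" and btw and scong and acong +
  assumes lines_nonempty: "lines \<noteq> {}"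
begin

lemma line_unique:
  "\<lbrakk>l \<in> lines; m \<in> lines; A \<noteq> B; A \<in> l; B \<in> l; A \<in> m; B \<in> m\<rbrakk> \<Longrightarrow> l = m"
  using I1 by metis

lemma line_props:
  assumes "A \<noteq> B"
  shows "line A B \<in> lines" "A \<in> line A B" "B \<in> line A B"
  using theI'[OF I1[OF assms]] unfolding line_def by auto

lemma line_eqI: "\<lbrakk>A \<noteq> B; l \<in> lines; A \<in> l; B \<in> l\<rbrakk> \<Longrightarrow> line A B = l"
  using line_unique line_props by metis

lemma line_commute: "line A B = line B A"
  unfolding line_def by meson

lemma collin_rotate: "collin A B C \<longleftrightarrow> collin B C A"
  and collin_swap: "collin A B C \<longleftrightarrow> collin B A C"
  unfolding collin_def by blast+

lemma not_collin_perms: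
  assumes "\<not> collin A B C"
  shows "\<not> collin B C A" "\<not> collin C A B" "\<not> collin A C B" "\<not> collin B A C" "\<not> collin C B A"
  using assms unfolding collin_def by blast+

lemma collin_iff: "A \<noteq> B \<Longrightarrow> collin A B C \<longleftrightarrow> C \<in> line A B"
  unfolding collin_def using line_eqI line_props by metis

lemma collin_degenerate: "collin A A B"
proof -
  obtain C where "C \<noteq> B" using I2 lines_nonempty by (metis all_not_in_conv)
  then show ?thesis
    using line_props[of A B] line_props[of B C] unfolding collin_def by (cases "A = B") auto
qed

lemma not_collin_distinct:
  "\<not> collin A B C \<Longrightarrow> A \<noteq> B \<and> B \<noteq> C \<and> A \<noteq> C"
  using collin_degenerate collin_rotate by metis

lemma not_collinI:
  "\<lbrakk>l \<in> lines; A \<in> l; B \<in> l; A \<noteq> B; C \<notin> l\<rbrakk> \<Longrightarrow> \<not> collin A B C"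
  using collin_iff line_eqI by metis

lemma exists_off_line:
  assumes "l \<in> lines" shows "\<exists>A. A \<notin> l"
  using I3 assms unfolding collin_def by blast

lemma btw_swap: "btw A B C \<Longrightarrow> btw C B A"
  and btw_distinct: "btw A B C \<Longrightarrow> A \<noteq> B \<and> B \<noteq> C \<and> A \<noteq> C"
  and btw_collin: "btw A B C \<Longrightarrow> collin A B C"
  using B1 by blast+

lemma btw_in_line:
  "\<lbrakk>btw A B C; l \<in> lines; A \<in> l; B \<in> l\<rbrakk> \<Longrightarrow> C \<in> l"
  "\<lbrakk>btw A B C; l \<in> lines; A \<in> l; C \<in> l\<rbrakk> \<Longrightarrow> B \<in> l"
  "\<lbrakk>btw A B C; l \<in> lines; B \<in> l; C \<in> l\<rbrakk> \<Longrightarrow> A \<in> l"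
  using btw_collin btw_distinct line_unique unfolding collin_def by metis+

lemma btw_exclusive: "btw A B C \<Longrightarrow> \<not> btw B A C \<and> \<not> btw A C B"
  using B1 B3 by metis

lemma parallel_sym: "parallel l m \<Longrightarrow> parallel m l"
  unfolding parallel_def by auto

lemma parallel_trans: "\<lbrakk>parallel l m; parallel m n\<rbrakk> \<Longrightarrow> parallel l n"
proof -
  assume lm: "parallel l m" and mn: "parallel m n"
  then have "l = n" if "A \<in> l" "A \<in> n" for A
    using P[of m l n A] that parallel_sym unfolding parallel_def by blast
  then show ?thesis using lm mn unfolding parallel_def by blast
qed

section \<open>The two sides of a line\<close>

definition opposite :: "'p set \<Rightarrow> 'p \<Rightarrow> 'p \<Rightarrow> bool" where
  "opposite l A B \<longleftrightarrow> A \<notin> l \<and> B \<notin> l \<and> (\<exists>C\<in>l. btw A C B)"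

lemma not_same_side_iff:
  "A \<notin> l \<Longrightarrow> B \<notin> l \<Longrightarrow> \<not> same_side l A B \<longleftrightarrow> opposite l A B"
  unfolding same_side_def opposite_def by auto

lemma same_side_sym: "same_side l A B \<Longrightarrow> same_side l B A"
  and opposite_sym: "opposite l A B \<Longrightarrow> opposite l B A"
  unfolding same_side_def opposite_def using btw_swap by blast+

lemma same_side_refl: "A \<notin> l \<Longrightarrow> same_side l A A"
  unfolding same_side_def using btw_distinct by blast

text \<open>
  A second line meets \<open>l\<close> in \<open>E\<close> only, so a segment of it crosses \<open>l\<close> only if \<open>E\<close> lies
  inside. This turns statements on order along a line into statements on sides.
\<close>

lemma same_side_along_line:
  assumes l: "l \<in> lines" "E \<in> l" "A \<notin> l" and n: "n \<in> lines" "A \<in> n" "E \<in> n" "D \<in> n"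
    and D: "D \<noteq> E" "\<not> btw A E D"
  shows "same_side l A D"
proof -
  have only_E: "X = E" if "X \<in> l" "X \<in> n" for X
    using line_unique[of l n X E] l n that by blast
  have "\<not> btw A X D" if "X \<in> l" for X
    using only_E[OF that] btw_in_line(2)[of A X D n] n D(2) by blast
  then show ?thesis unfolding same_side_def using l n D only_E by blast
qed

lemma opposite_iff_noncollin:
  assumes "\<not> collin A B C" "l \<in> lines" "C \<notin> l" "opposite l A B"
  shows "opposite l A C \<longleftrightarrow> \<not> opposite l B C"
  using B4[OF assms(1,2) _ _ assms(3)] assms unfolding opposite_def by blast

lemma same_side_trans_noncollin:
  assumes "\<not> collin A B C" "l \<in> lines" "same_side l A B" "same_side l B C"
  shows "same_side l A C"
proof (rule ccontr)
  have off: "A \<notin> l" "B \<notin> l" "C \<notin> l" using assms(3,4) unfolding same_side_def by auto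
  assume "\<not> same_side l A C"
  then have "opposite l A C" using not_same_side_iff off by blast
  moreover have "\<not> collin A C B" using assms(1) collin_rotate collin_swap by blast
  ultimately have "opposite l A B \<or> opposite l C B"
    using opposite_iff_noncollin assms(2) off by blast
  then show False
    using assms(3,4) same_side_sym[OF assms(4)] unfolding same_side_def opposite_def by blast
qed

text \<open>
  Pasch's axiom speaks about triangles only. For three points on a line \<open>n\<close>, this lemma provides
  a further point off \<open>n\<close> with which triangles can be formed: prolong a segment from a
  point of \<open>l\<close> through \<open>A\<close>.
\<close>

lemma exists_same_side_off_line:
  assumes l: "l \<in> lines" "A \<notin> l" and n: "n \<in> lines" "A \<in> n"
  shows "\<exists>D. D \<notin> n \<and> same_side l A D"
proof -
  obtain E where E: "E \<in> l" "E \<notin> n" using I2[OF l(1)] line_unique l n by metis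
  then have EA: "E \<noteq> A" using n by blast
  then obtain D where D: "btw E A D" using B2 by blast
  have "D \<notin> n" using btw_in_line(3)[OF D n] E(2) by blast
  moreover have "same_side l A D"
    using same_side_along_line[of l E A "line E A" D] l E EA D line_props[OF EA]
      btw_in_line(1) btw_exclusive btw_distinct by blast
  ultimately show ?thesis by blast
qed

lemma same_side_trans:
  assumes l: "l \<in> lines" and AB: "same_side l A B" and BC: "same_side l B C"
  shows "same_side l A C"
proof (cases "collin A B C")
  case False
  then show ?thesis using same_side_trans_noncollin assms by blast
next
  case True
  then obtain n where n: "n \<in> lines" "A \<in> n" "B \<in> n" "C \<in> n" unfolding collin_def by blast
  have off: "A \<notin> l" "B \<notin> l" "C \<notin> l" using AB BC unfolding same_side_def by auto
  obtain D where D: "D \<notin> n" "same_side l A D"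
    using exists_same_side_off_line l off n by blast
  have nc: "\<not> collin X Y D" if "X \<in> n" "Y \<in> n" "X \<noteq> Y" for X Y
    using not_collinI n D(1) that by blast
  \<comment> \<open>The auxiliary point is carried along from \<open>A\<close> to \<open>B\<close> to \<open>C\<close> through proper triangles.\<close>
  have BD: "same_side l B D"
  proof (cases "A = B")
    case False
    have "\<not> collin B A D" using nc n False by blast
    then show ?thesis using same_side_trans_noncollin l AB D same_side_sym by blast
  qed (use D in simp)
  have CD: "same_side l C D"
  proof (cases "B = C")
    case False
    have "\<not> collin C B D" using nc n False by blast
    then show ?thesis using same_side_trans_noncollin l BC BD same_side_sym by blast
  qed (use BD in simp)
  show ?thesis
  proof (cases "A = C")
    case False
    have "\<not> collin A D C" using nc[of A C] n False collin_rotate collin_swap by blast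
    then show ?thesis using same_side_trans_noncollin l D CD same_side_sym by blast
  qed (use same_side_refl off in simp)
qed

lemma same_side_opposite:
  assumes "l \<in> lines" "same_side l A B" "opposite l B C"
  shows "opposite l A C"
proof (rule ccontr)
  assume "\<not> opposite l A C"
  then have "same_side l A C"
    using not_same_side_iff assms unfolding same_side_def opposite_def by blast
  then have "same_side l B C" using same_side_trans same_side_sym assms by blast
  then show False using assms(3) unfolding same_side_def opposite_def by blast
qed

text \<open>
  A line has no more than two sides. For a proper triangle this is the exclusive disjunction in
  Pasch's axiom; in the collinear case \<open>A\<close> is replaced by a point off the common line.
\<close>

lemma opposite_opposite:
  assumes l: "l \<in> lines" and AB: "opposite l A B" and BC: "opposite l B C"
  shows "same_side l A C"
proof -
  have off: "A \<notin> l" "B \<notin> l" "C \<notin> l" using AB BC unfolding opposite_def by auto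
  have *: "same_side l D C" if "opposite l D B" "\<not> collin D B C" "D \<notin> l" for D
    using opposite_iff_noncollin[OF that(2) l off(3) that(1)] not_same_side_iff off that BC by blast
  show ?thesis
  proof (cases "collin A B C")
    case False
    then show ?thesis using * AB off by blast
  next
    case True
    then obtain n where n: "n \<in> lines" "A \<in> n" "B \<in> n" "C \<in> n" unfolding collin_def by blast
    obtain D where D: "D \<notin> n" "same_side l A D"
      using exists_same_side_off_line l off n by blast
    have "B \<noteq> C" using BC btw_distinct unfolding opposite_def by blast
    then have "\<not> collin D B C"
      using not_collinI[of n B C D] n D(1) collin_rotate collin_swap by blast
    moreover have "opposite l D B" using same_side_opposite same_side_sym D AB l by blast
    ultimately have "same_side l D C" using * unfolding opposite_def by blast
    then show ?thesis using same_side_trans l D by blast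
  qed
qed

lemma opposite_transfer:
  assumes "l \<in> lines" "same_side l A A'" "same_side l C C'" "opposite l A C"
  shows "opposite l A' C'"
proof -
  have "opposite l A' C" by (rule same_side_opposite[OF assms(1) same_side_sym[OF assms(2)] assms(4)])
  then have "opposite l C' A'"
    by (rule same_side_opposite[OF assms(1) same_side_sym[OF assms(3)] opposite_sym])
  then show ?thesis by (rule opposite_sym)
qed

lemma opposite_through:
  "\<lbrakk>l \<in> lines; A \<notin> l; M \<in> l; btw A M B\<rbrakk> \<Longrightarrow> opposite l A B"
  unfolding opposite_def using btw_in_line(3) by blast

lemma opposite_meet:
  assumes "opposite l A B" "l \<in> lines" "n \<in> lines" "A \<in> n" "B \<in> n" "M \<in> l" "M \<in> n"
  shows "btw A M B"
proof -
  obtain E where E: "E \<in> l" "btw A E B" using assms(1) unfolding opposite_def by blast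
  have "E \<in> n" using btw_in_line(2) E assms by blast
  moreover have "A \<notin> l" using assms(1) unfolding opposite_def by blast
  ultimately have "E = M" using line_unique[of l n E M] E assms by blast
  then show ?thesis using E by blast
qed

lemma parallel_same_side:
  assumes "parallel l n" "l \<noteq> n" "A \<in> n" "B \<in> n"
  shows "same_side l A B"
  using assms btw_in_line(2)[of A _ B n] unfolding parallel_def same_side_def by blast

section \<open>Rays\<close>

lemma ray_iff: "A \<noteq> B \<Longrightarrow> C \<in> ray A B \<longleftrightarrow> C \<in> line A B \<and> C \<noteq> A \<and> \<not> btw B A C"
proof -
  assume AB: "A \<noteq> B"
  show ?thesis
  proof (cases "C = B \<or> C = A")
    case True
    then show ?thesis unfolding ray_def using AB line_props[OF AB] btw_distinct by blast
  next
    case False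
    have "btw A B C \<or> btw B A C \<or> btw A C B" if "C \<in> line A B"
      using B3[of A B C] collin_iff[OF AB, of C] that AB False by auto
    moreover have "C \<in> line A B" if "btw A B C \<or> btw B A C \<or> btw A C B"
      using that line_props[OF AB] btw_in_line(1)[of A B C "line A B"]
        btw_in_line(1)[of B A C "line A B"] btw_in_line(2)[of A C B "line A B"] by auto
    ultimately have "C \<in> line A B \<longleftrightarrow> btw A B C \<or> btw B A C \<or> btw A C B" by (rule iffI)
    moreover have "\<not> (btw B A C \<and> btw A C B)" "\<not> (btw B A C \<and> btw A B C)"
      using btw_exclusive btw_swap by blast+
    ultimately show ?thesis unfolding ray_def using False by auto
  qed
qed

lemma ray_self: "B \<in> ray A B"
  unfolding ray_def by blast

text \<open>
  A ray is a half of its line as cut off by any transversal through the origin. Order along a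
  line thereby inherits the transitivity of \<^const>\<open>same_side\<close>.
\<close>

lemma ray_same_side:
  assumes "l \<in> lines" "A \<in> l" "B \<notin> l"
  shows "C \<in> ray A B \<longleftrightarrow> C \<in> line A B \<and> same_side l B C"
proof -
  have AB: "A \<noteq> B" using assms by blast
  show ?thesis
  proof
    assume "C \<in> ray A B"
    then show "C \<in> line A B \<and> same_side l B C"
      using ray_iff[OF AB] same_side_along_line[of l A B "line A B" C] assms line_props[OF AB]
      by blast
  next
    assume "C \<in> line A B \<and> same_side l B C"
    then show "C \<in> ray A B" using ray_iff[OF AB] assms unfolding same_side_def by blast
  qed
qed

lemma ray_eq:
  assumes AB: "A \<noteq> B" and C: "C \<in> ray A B"
  shows "ray A C = ray A B"
proof -
  obtain D where D: "D \<notin> line A B" using exists_off_line line_props[OF AB] by blast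
  then have AD: "A \<noteq> D" using line_props[OF AB] by blast
  let ?l = "line A D"
  have l: "?l \<in> lines" "A \<in> ?l" using line_props[OF AD] by auto
  have B: "B \<notin> ?l"
    using D line_unique[of ?l "line A B" A B] AB line_props[OF AB] line_props[OF AD] by auto
  have s: "same_side ?l B C" using C ray_same_side[OF l B] by blast
  then have C': "C \<notin> ?l" unfolding same_side_def by blast
  have "A \<noteq> C" "C \<in> line A B" using C ray_iff[OF AB] by auto
  then have "line A C = line A B" using line_eqI line_props[OF AB] by auto
  moreover have "same_side ?l C X \<longleftrightarrow> same_side ?l B X" for X
    using same_side_trans[OF l(1) s, of X] same_side_trans[OF l(1) same_side_sym[OF s], of X]
    by auto
  ultimately have "X \<in> ray A C \<longleftrightarrow> X \<in> ray A B" for X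
    using ray_same_side[OF l B, of X] ray_same_side[OF l C', of X] by simp
  then show ?thesis by blast
qed

lemma ray_distinct: "A \<noteq> B \<Longrightarrow> C \<in> ray A B \<Longrightarrow> C \<noteq> A"
  using ray_iff by blast

text \<open>
  Two opposite rays are separated by a transversal through their origin; any choice of points on
  them inherits this.
\<close>

lemma btw_rays:
  assumes b: "btw A B C" and A': "A' \<in> ray B A" and C': "C' \<in> ray B C"
  shows "btw A' B C'"
proof -
  have d: "A \<noteq> B" "B \<noteq> C" using btw_distinct[OF b] by auto
  let ?n = "line B A"
  have n: "?n \<in> lines" "B \<in> ?n" "A \<in> ?n" using line_props[of B A] d by auto
  have C: "C \<in> ?n" using btw_in_line(1)[OF b] n by blast
  have nC: "line B C = ?n" using line_eqI d n C by blast
  obtain D where D: "D \<notin> ?n" using exists_off_line n by blast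
  have BD: "B \<noteq> D" using D n by blast
  let ?l = "line B D"
  have l: "?l \<in> lines" "B \<in> ?l" "D \<in> ?l" using line_props[OF BD] by auto
  have "X \<notin> ?l" if "X \<in> ?n" "X \<noteq> B" for X
    using line_unique[of ?l ?n X B] that l n D by auto
  then have off: "A \<notin> ?l" "C \<notin> ?l" using n C d by auto
  have 1: "same_side ?l A A'" "A' \<in> ?n"
    using ray_same_side[OF l(1,2) off(1), of A'] A' by auto
  have 2: "same_side ?l C C'" "C' \<in> ?n"
    using ray_same_side[OF l(1,2) off(2), of C'] C' nC by auto
  have "opposite ?l A C" by (rule opposite_through[OF l(1) off(1) l(2) b])
  then have "opposite ?l A' C'" by (rule opposite_transfer[OF l(1) 1(1) 2(1)])
  then show ?thesis by (rule opposite_meet[OF _ l(1) n(1) 1(2) 2(2) l(2) n(2)])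
qed

section \<open>Congruence of segments and angles\<close>

lemma segmentI: "A \<noteq> B \<Longrightarrow> {A, B} \<in> segments"
  unfolding segments_def by blast

lemma angleI: "\<not> collin A B C \<Longrightarrow> angle A B C \<in> angles"
  unfolding angles_def by blast

lemma angle_commute: "angle A B C = angle C B A"
  unfolding angle_def by blast

lemma angle_rays:
  "\<lbrakk>B \<noteq> A; B \<noteq> C; A' \<in> ray B A; C' \<in> ray B C\<rbrakk> \<Longrightarrow> angle A' B C' = angle A B C"
  unfolding angle_def using ray_eq by metis

lemma scong_sym: "\<lbrakk>S \<in> segments; T \<in> segments; scong S T\<rbrakk> \<Longrightarrow> scong T S"
  using C2 C2_refl by blast

lemma scong_trans:
  "\<lbrakk>S \<in> segments; T \<in> segments; U \<in> segments; scong S T; scong T U\<rbrakk> \<Longrightarrow> scong S U"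
  using C2 scong_sym by blast

lemma acong_sym: "\<lbrakk>\<alpha> \<in> angles; \<beta> \<in> angles; acong \<alpha> \<beta>\<rbrakk> \<Longrightarrow> acong \<beta> \<alpha>"
  using C5 C5_refl by blast

lemma lay_off:
  assumes "X \<noteq> Y" "A \<noteq> B" obtains C where "C \<in> ray A B" "scong {X, Y} {A, C}"
  using C1[OF segmentI] assms by blast

lemma angle_side_unique:
  assumes "A \<noteq> B" "same_side (line A B) D C" "\<alpha> \<in> angles"
    "acong \<alpha> (angle B A D)" "acong \<alpha> (angle B A C)"
  shows "ray A D = ray A C"
proof -
  have "D \<notin> line A B" using assms(2) unfolding same_side_def by blast
  then show ?thesis
    using C4[OF assms(3,1), of D] assms same_side_refl[of D "line A B"] by blast
qed

lemma noncollin_rays: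
  assumes "\<not> collin B A C" "A' \<in> ray B A" "C' \<in> ray B C"
  shows "\<not> collin B A' C'"
proof
  assume c: "collin B A' C'"
  have d: "B \<noteq> A" "B \<noteq> C" using not_collin_distinct assms by blast+
  have d': "B \<noteq> A'" "B \<noteq> C'" using ray_distinct assms d by blast+
  have "line B A' = line B A" "line B C' = line B C"
    using line_eqI d' ray_iff d assms line_props by metis+
  moreover have "line B A' = line B C'"
    using c line_eqI[of B C' "line B A'"] d' collin_iff line_props by blast
  ultimately show False using collin_iff[of B A C] line_props d assms by metis
qed

text \<open>
  Choose the second figure with the same lengths as the first. Then side-angle-side applies
  three times: to the triangles \<open>BAD\<close>, \<open>ACD\<close> and \<open>CBD\<close>, where each application yields the
  side and the angle for the next one.
\<close>

lemma supplements_congruent: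
  assumes b: "btw A B C" and b0: "btw A0 B' C0"
    and nc: "\<not> collin A B D" and nc0: "\<not> collin A0 B' D0"
    and ang: "acong (angle A B D) (angle A0 B' D0)"
  shows "acong (angle C B D) (angle C0 B' D0)"
proof -
  note dist = btw_distinct[OF b] btw_distinct[OF b0] not_collin_distinct[OF nc]
    not_collin_distinct[OF nc0]
  obtain A' where A': "A' \<in> ray B' A0" "scong {B, A} {B', A'}" using lay_off dist by metis
  obtain C' where C': "C' \<in> ray B' C0" "scong {B, C} {B', C'}" using lay_off dist by metis
  obtain D' where D': "D' \<in> ray B' D0" "scong {B, D} {B', D'}" using lay_off dist by metis
  have b': "btw A' B' C'" using btw_rays b0 A' C' by blast
  have ncB': "\<not> collin B' A' D'" using noncollin_rays[of B' A0 D0] nc0 A' D' collin_swap by blast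
  have ncB: "\<not> collin B A D" using nc collin_swap by blast
  note dist' = btw_distinct[OF b'] not_collin_distinct[OF ncB']
  have "angle A' B' D' = angle A0 B' D0" using angle_rays A' D' dist by metis
  then have sas1: "scong {A, D} {A', D'}" "acong (angle B A D) (angle B' A' D')"
    using C6[OF ncB ncB' A'(2) D'(2)] ang by auto
  \<comment> \<open>The second triangle uses the whole side \<open>AC\<close> and the angle at \<open>A\<close> just obtained.\<close>
  have AC: "scong {A, C} {A', C'}"
    using C3[OF b b'] A'(2) C'(2) by (simp add: insert_commute)
  have ncs: "\<not> collin A C D" if "btw A B C" "\<not> collin B A D" for A B C D
    using that not_collinI[of "line A B" A C D] line_props[of A B] btw_distinct btw_in_line(1)
      collin_iff[of B A D] line_commute by metis
  have ncA: "\<not> collin A C D" and ncA': "\<not> collin A' C' D'"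
    using ncs b b' ncB ncB' by blast+
  have ray1: "angle C A D = angle B A D" if "btw A B C" "\<not> collin B A D" for A B C D
    using angle_rays[of A B D C D] that btw_distinct not_collin_distinct ray_self
    unfolding ray_def by blast
  have "acong (angle C A D) (angle C' A' D')" using ray1 b b' ncB ncB' sas1 by metis
  then have sas2: "scong {C, D} {C', D'}" "acong (angle A C D) (angle A' C' D')"
    using C6[OF ncA ncA' AC sas1(1)] by auto
  have ncC: "\<not> collin C B D" "\<not> collin C' B' D'"
  proof -
    have "\<not> collin C B D" if "btw A B C" "\<not> collin B A D" for A B C D
      using that not_collinI[of "line A B" C B D] line_props[of A B] btw_distinct btw_in_line(1)
        collin_iff[of B A D] line_commute by metis
    then show "\<not> collin C B D" "\<not> collin C' B' D'" using b b' ncB ncB' by blast+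
  qed
  \<comment> \<open>The third triangle uses the angle at \<open>C\<close>, whose side through \<open>A\<close> also passes through \<open>B\<close>.\<close>
  have ray2: "angle B C D = angle A C D" if "btw A B C" "\<not> collin C B D" for A B C D
  proof -
    have "B \<in> ray C A" using btw_swap that unfolding ray_def by blast
    then show ?thesis
      using angle_rays[of C A D B D] that btw_distinct not_collin_distinct ray_self by metis
  qed
  have "acong (angle B C D) (angle B' C' D')" using ray2 b b' ncC sas2 by metis
  then have "acong (angle C B D) (angle C' B' D')"
    using C6[OF ncC _ sas2(1)] C'(2) by (simp add: insert_commute)
  moreover have "angle C' B' D' = angle C0 B' D0" using angle_rays C' D' dist by metis
  ultimately show ?thesis by simp
qed

text \<open>Both angles are supplements of \<open>AME\<close>.\<close>

lemma vertical_angles: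
  assumes "btw A M C" "btw D M E" "\<not> collin A M D"
  shows "acong (angle A M D) (angle C M E)"
proof -
  note d = not_collin_distinct[OF assms(3)] btw_distinct[OF assms(2)]
  have MD: "M \<noteq> D" using d by blast
  have "A \<notin> line M D" using not_collin_perms(1)[OF assms(3)] collin_iff[OF MD] by blast
  then have "\<not> collin M E A"
    using not_collinI[of "line M D" M E A] btw_in_line(1)[OF assms(2)] line_props[OF MD] d
    by blast
  then have nc: "\<not> collin A M E" "\<not> collin E M A" using not_collin_perms by blast+
  have "acong (angle E M A) (angle A M E)"
    using C5_refl[OF angleI[OF nc(1)]] angle_commute[of E M A] by simp
  then show ?thesis
    using supplements_congruent[OF btw_swap[OF assms(2)] assms(1) nc(2,1)] angle_commute[of D M A]
    by simp
qed

section \<open>Parallels and alternate angles\<close>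

text \<open>
  If the lines met in \<open>Z\<close> on one side of the transversal, then copying the segment \<open>XZ\<close> to the
  other side, as \<open>AW\<close>, would produce two congruent triangles on the common side \<open>AX\<close>. Comparing
  the angles at \<open>X\<close> shows that \<open>W\<close> lies on the line \<open>XZ\<close> as well, so the two lines would
  share the distinct points \<open>Z\<close> and \<open>W\<close>.
\<close>

lemma alternate_angles_ray_disjoint:
  assumes nc: "\<not> collin A X Y" and opp: "opposite (line A X) Y C"
    and ang: "acong (angle A X Y) (angle X A C)"
    and Z: "Z \<in> ray X Y" "Z \<in> line A C"
  shows False
proof -
  let ?t = "line A X"
  note d = not_collin_distinct[OF nc]
  have t: "?t \<in> lines" "A \<in> ?t" "X \<in> ?t" using line_props[of A X] d by auto
  have off: "Y \<notin> ?t" "C \<notin> ?t" using opp unfolding opposite_def by auto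
  then have AC: "A \<noteq> C" using t by blast
  have ncC: "\<not> collin A X C" using collin_iff d off by blast
  have sZ: "same_side ?t Y Z" using ray_same_side[OF t(1) t(3) off(1)] Z by blast
  then have Zt: "Z \<notin> ?t" unfolding same_side_def by blast
  have dZ: "Z \<noteq> X" "Z \<noteq> A" using Zt t by blast+
  obtain W where W: "W \<in> ray A C" "scong {X, Z} {A, W}" using lay_off dZ AC by metis
  have sW: "same_side ?t C W" "W \<in> line A C" using ray_same_side[OF t(1) t(2) off(2)] W by auto
  then have Wt: "W \<notin> ?t" unfolding same_side_def by blast
  have oZW: "opposite ?t Z W"
    by (rule opposite_transfer[OF t(1) sZ sW(1) opp])
  have lAC: "line A C \<in> lines" "A \<in> line A C" using line_props[OF AC] by auto
  have bZ: "btw Z A W" using opposite_meet[OF oZW t(1) lAC(1) Z(2) sW(2) t(2) lAC(2)] .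
  have nc1: "\<not> collin X Z A" "\<not> collin A X Z" "\<not> collin Z X A" "\<not> collin Z A X"
    using not_collinI[of ?t A X Z] t d Zt collin_rotate collin_swap by blast+
  have nc2: "\<not> collin A W X" "\<not> collin A X W" "\<not> collin W A X"
    using not_collinI[of ?t A X W] t d Wt collin_rotate collin_swap by blast+
  have a1: "angle Z X A = angle Y X A" using angle_rays[of X Y A Z A] Z d ray_self by blast
  have a2: "angle W A X = angle C A X" using angle_rays[of A C X W X] W d AC ray_self by blast
  have ZW: "acong (angle Z X A) (angle W A X)" using ang a1 a2 angle_commute by metis
  have sXA: "scong {X, A} {A, X}" using C2_refl segmentI d by (metis insert_commute)
  have r: "acong (angle X A Z) (angle A X W)"
    using C6[OF nc1(1) nc2(1) W(2) sXA ZW] by blast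
  \<comment> \<open>The rays from \<open>X\<close> to \<open>V\<close> and to \<open>W\<close> make the same angle with \<open>XA\<close> on the same side.\<close>
  obtain V where V: "btw Z X V" using B2 dZ by blast
  have oV: "opposite ?t Z V" using opposite_through t Zt V by blast
  have ncV: "\<not> collin V X A"
    using not_collinI[of ?t A X V] oV t d collin_rotate collin_swap unfolding opposite_def by blast
  have "acong (angle W A X) (angle Z X A)"
    using acong_sym angleI nc1 nc2 ZW by blast
  then have s: "acong (angle Z A X) (angle V X A)"
    using supplements_congruent[OF btw_swap[OF bZ] V nc2(3) nc1(3)] by blast
  have "same_side ?t W V" by (rule opposite_opposite[OF t(1) opposite_sym[OF oZW] oV])
  then have "ray X W = ray X V"
    using angle_side_unique[of X A W V "angle X A Z"] d r s line_commute angle_commute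
      angleI[OF nc1(4)] by metis
  then have "W \<in> ray X V" using ray_self by blast
  then have "W \<in> line X V" using ray_iff[of X V W] btw_distinct[OF V] by blast
  moreover have XV: "X \<noteq> V" using btw_distinct[OF V] by blast
  ultimately have "Z \<in> line X V" "W \<in> line X V"
    using btw_in_line(3)[OF V] line_props[OF XV] by blast+
  moreover have "Z \<noteq> W" using btw_distinct[OF bZ] by blast
  ultimately have "line X V = line A C"
    using line_unique[of "line X V" "line A C" Z W] line_props[OF XV] lAC Z sW by blast
  then have "collin X Z A"
    unfolding collin_def using line_props[OF XV] lAC Z by blast
  then show False using nc1 by blast
qed

text \<open>
  The hypotheses are symmetric under exchange of the two lines, so a meeting point on either side
  of the transversal is excluded by the preceding lemma.
\<close>

lemma alternate_angles_parallel:
  assumes nc: "\<not> collin A X Y" and opp: "opposite (line A X) Y C"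
    and ang: "acong (angle A X Y) (angle X A C)"
  shows "parallel (line X Y) (line A C)"
proof -
  let ?t = "line A X"
  note d = not_collin_distinct[OF nc]
  have t: "?t \<in> lines" "A \<in> ?t" "X \<in> ?t" using line_props[of A X] d by auto
  have off: "Y \<notin> ?t" "C \<notin> ?t" using opp unfolding opposite_def by auto
  then have AC: "A \<noteq> C" using t by blast
  have nc': "\<not> collin X A C" using collin_iff[of X A C] d off line_commute by metis
  have XY: "X \<noteq> Y" using d by blast
  have "False" if Z: "Z \<in> line X Y" "Z \<in> line A C" for Z
  proof (cases "Z \<in> ?t")
    case True
    have "Z = X" using line_unique[of ?t "line X Y" Z X] True t line_props[OF XY] Z off by blast
    moreover have "Z = A" using line_unique[of ?t "line A C" Z A] True t line_props[OF AC] Z off by blast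
    ultimately show False using d by blast
  next
    case False
    show False
    proof (cases "same_side ?t Y Z")
      case True
      then have "Z \<in> ray X Y" using ray_same_side t off Z by blast
      then show False using alternate_angles_ray_disjoint[OF nc opp ang] Z by blast
    next
      case Fl: False
      then have "opposite ?t Y Z" using not_same_side_iff off False by blast
      then have "same_side ?t C Z" by (rule opposite_opposite[OF t(1) opposite_sym[OF opp]])
      then have "Z \<in> ray A C" using ray_same_side t off Z by blast
      moreover have "acong (angle X A C) (angle A X Y)"
        using acong_sym angleI nc nc' ang by blast
      moreover have "opposite (line X A) C Y" using opp opposite_sym line_commute by metis
      ultimately show False using alternate_angles_ray_disjoint[OF nc'] Z by blast
    qed
  qed
  then show ?thesis unfolding parallel_def using line_props[OF XY] line_props[OF AC] by blast
qed

lemma exists_alternate_angle: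
  assumes nc: "\<not> collin A X Y"
  obtains C where "opposite (line A X) Y C" "acong (angle A X Y) (angle X A C)"
proof -
  let ?t = "line A X"
  note d = not_collin_distinct[OF nc]
  have t: "?t \<in> lines" "A \<in> ?t" "X \<in> ?t" using line_props[of A X] d by auto
  have Y: "Y \<notin> ?t" using nc collin_iff d by blast
  obtain Q where Q: "btw Y X Q" using B2 d by metis
  have oQ: "opposite ?t Y Q" using opposite_through t Y Q by blast
  then have "Q \<notin> ?t" unfolding opposite_def by blast
  then obtain C where C: "same_side ?t Q C" "acong (angle A X Y) (angle X A C)"
    using C4[OF angleI[OF nc], of A X Q] d by blast
  have "opposite ?t Y C"
    by (rule opposite_transfer[OF t(1) same_side_refl[OF Y] C(1) oQ])
  then show ?thesis using that C by blast
qed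

lemma exists_parallel:
  assumes "l \<in> lines" shows "\<exists>m. A \<in> m \<and> parallel m l"
proof (cases "A \<in> l")
  case True
  then show ?thesis using assms unfolding parallel_def by blast
next
  case False
  obtain X Y where XY: "X \<in> l" "Y \<in> l" "X \<noteq> Y" using I2 assms by blast
  have nc: "\<not> collin A X Y" using not_collinI assms XY False collin_rotate by blast
  obtain C where C: "opposite (line A X) Y C" "acong (angle A X Y) (angle X A C)"
    using exists_alternate_angle[OF nc] by blast
  have "parallel (line X Y) (line A C)" using alternate_angles_parallel nc C by blast
  moreover have "A \<noteq> C" using C(1) line_props[of A X] not_collin_distinct[OF nc]
    unfolding opposite_def by blast
  ultimately show ?thesis using line_props[of A C] line_eqI XY assms parallel_sym by metis
qed

text \<open>
  The line at \<open>A\<close> drawn with the equal alternate angle is parallel to \<open>XY\<close>; by the parallel axiom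
  it is the line \<open>AD\<close>.
\<close>

lemma parallel_alternate_angles:
  assumes nc: "\<not> collin A X Y" and opp: "opposite (line A X) Y D"
    and par: "parallel (line X Y) (line A D)"
  shows "acong (angle A X Y) (angle X A D)"
proof -
  let ?t = "line A X"
  note d = not_collin_distinct[OF nc]
  have t: "?t \<in> lines" "A \<in> ?t" "X \<in> ?t" using line_props[of A X] d by auto
  obtain C where C: "opposite ?t Y C" "acong (angle A X Y) (angle X A C)"
    using exists_alternate_angle[OF nc] by blast
  have off: "D \<notin> ?t" "C \<notin> ?t" using C opp unfolding opposite_def by auto
  have AC: "A \<noteq> C" "A \<noteq> D" using off t by auto
  have "parallel (line X Y) (line A C)" using alternate_angles_parallel nc C by blast
  then have "line A C = line A D"
    using P[of "line X Y" "line A C" "line A D" A] par parallel_sym AC line_props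
    by (metis parallel_def)
  moreover have "same_side ?t D C"
    by (rule opposite_opposite[OF t(1) opposite_sym[OF opp] C(1)])
  ultimately have "C \<in> ray A D" using ray_same_side[OF t(1,2) off(1)] line_props[OF AC(1)] by blast
  then show ?thesis using C angle_rays[of A X D X C] d AC ray_self by metis
qed

section \<open>Point reflections and midlines\<close>

definition midpoint :: "'p \<Rightarrow> 'p \<Rightarrow> 'p \<Rightarrow> bool" where
  "midpoint M A B \<longleftrightarrow> btw A M B \<and> scong {A, M} {M, B}"

lemma exists_reflected_point:
  assumes "M \<noteq> A" obtains B where "midpoint M A B"
proof -
  obtain Q where Q: "btw A M Q" using B2 assms by metis
  then obtain B where B: "B \<in> ray M Q" "scong {A, M} {M, B}"
    using lay_off[of A M M Q] assms btw_distinct by metis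
  have "btw A M B" using btw_rays Q B ray_self by blast
  then show ?thesis using that B unfolding midpoint_def by blast
qed

text \<open>
  The triangles \<open>MXY\<close> and \<open>MX'Y'\<close> are congruent by side-angle-side with vertical angles at
  \<open>M\<close>, and their angles at \<open>X\<close> and \<open>X'\<close> are alternate.
\<close>

lemma point_reflection:
  assumes X: "midpoint M X X'" and Y: "midpoint M Y Y'" and nc: "\<not> collin M X Y"
  shows "parallel (line X Y) (line X' Y')" "scong {X, Y} {X', Y'}"
proof -
  have b: "btw X M X'" "btw Y M Y'" and s: "scong {M, X} {M, X'}" "scong {M, Y} {M, Y'}"
    using X Y unfolding midpoint_def by (auto simp: insert_commute)
  note d = btw_distinct[OF b(1)] btw_distinct[OF b(2)] not_collin_distinct[OF nc]
  let ?t = "line X' X"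
  have t: "?t \<in> lines" "X \<in> ?t" "X' \<in> ?t" using line_props[of X' X] d by auto
  have M: "M \<in> ?t" using btw_in_line(2) b t by blast
  have Yt: "Y \<notin> ?t" using nc M t unfolding collin_def by blast
  have opp: "opposite ?t Y Y'" using opposite_through t Yt M b by blast
  then have Yt': "Y' \<notin> ?t" unfolding opposite_def by blast
  have nc': "\<not> collin M X' Y'" using not_collinI[of ?t M X' Y'] t M Yt' d by blast
  have "\<not> collin X M Y" using nc collin_swap by blast
  then have c: "scong {X, Y} {X', Y'}" "acong (angle M X Y) (angle M X' Y')"
    using C6[OF nc nc' s] vertical_angles b by auto
  show "scong {X, Y} {X', Y'}" using c by blast
  have "M \<in> ray X X'" "M \<in> ray X' X" using b btw_swap unfolding ray_def by blast+
  moreover have "X \<noteq> Y" "X' \<noteq> Y'" using Yt Yt' t by blast+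
  ultimately have "acong (angle X' X Y) (angle X X' Y')"
    using c(2) angle_rays[of X X' Y M Y] angle_rays[of X' X Y' M Y'] d ray_self by metis
  moreover have "\<not> collin X' X Y" using not_collinI[of ?t X' X Y] t Yt d by blast
  ultimately show "parallel (line X Y) (line X' Y')" using alternate_angles_parallel opp by blast
qed

text \<open>
  Let \<open>D\<close> be the reflection of \<open>M\<close> in \<open>N\<close>. Reflecting the triangle \<open>QMN\<close> gives that \<open>BD\<close> is
  parallel and congruent to \<open>QM\<close>, hence to \<open>MA\<close>. So \<open>MABD\<close> has two opposite sides that are
  parallel and congruent. By side-angle-side on its diagonal \<open>MB\<close>, the other two sides
  \<open>AB\<close> and \<open>MD\<close> are parallel, and \<open>MD\<close> is the line \<open>MN\<close>.
\<close>

lemma triangle_midline: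
  assumes nc: "\<not> collin Q A B" and M: "midpoint M Q A" and N: "midpoint N Q B"
  shows "parallel (line M N) (line A B)"
proof -
  have b: "btw Q M A" "btw Q N B" using M N unfolding midpoint_def by auto
  note d = btw_distinct[OF b(1)] btw_distinct[OF b(2)] not_collin_distinct[OF nc]
  let ?a = "line Q A" and ?b = "line Q B"
  have a: "?a \<in> lines" "Q \<in> ?a" "A \<in> ?a" "M \<in> ?a"
    using line_props[of Q A] d btw_in_line(2)[OF b(1)] by auto
  have bl: "?b \<in> lines" "Q \<in> ?b" "B \<in> ?b" "N \<in> ?b"
    using line_props[of Q B] d btw_in_line(2)[OF b(2)] by auto
  have Ba: "B \<notin> ?a" using nc collin_iff d by blast
  have Mb: "M \<notin> ?b" using line_unique[of ?a ?b Q M] a bl Ba d by blast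
  have MN: "M \<noteq> N" using Mb bl by blast
  obtain D where D: "midpoint N M D" using exists_reflected_point MN by metis
  have bD: "btw M N D" using D unfolding midpoint_def by blast
  note dD = btw_distinct[OF bD]
  have Db: "D \<notin> ?b" using opposite_through[OF bl(1) Mb bl(4) bD] unfolding opposite_def by blast
  have "\<not> collin N Q M" using not_collinI[of ?b N Q M] bl d Mb by blast
  then have p1: "parallel (line Q M) (line B D)" "scong {Q, M} {B, D}"
    using point_reflection[OF N D] by auto
  \<comment> \<open>\<open>QD\<close> and \<open>BM\<close> are parallel too, which places \<open>A\<close> and \<open>D\<close> on opposite sides of \<open>BM\<close>.\<close>
  have BNQ: "midpoint N B Q"
    using N btw_swap scong_sym segmentI d unfolding midpoint_def by (metis insert_commute)
  have "\<not> collin N B M" using not_collinI[of ?b N B M] bl d Mb by blast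
  then have p2: "parallel (line B M) (line Q D)" using point_reflection(1)[OF BNQ D] by blast
  have BM: "B \<noteq> M" "Q \<noteq> D" "B \<noteq> D" using Mb Db bl by blast+
  let ?t = "line B M"
  have t: "?t \<in> lines" "B \<in> ?t" "M \<in> ?t" using line_props[OF BM(1)] by auto
  have tM: "X \<notin> ?t" if "X \<in> ?a" "X \<noteq> M" for X
    using line_unique[of ?t ?a X M] that t a Ba by blast
  have Qt: "Q \<notin> ?t" and At: "A \<notin> ?t" using tM a d by blast+
  have "?t \<noteq> line Q D" using Qt line_props[OF BM(2)] by blast
  then have "same_side ?t Q D" using parallel_same_side p2 line_props[OF BM(2)] by blast
  moreover have "opposite ?t A Q"
    by (rule opposite_sym[OF opposite_through[OF t(1) Qt t(3) b(1)]])
  ultimately have opp: "opposite ?t A D"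
    using opposite_transfer[OF t(1) same_side_refl[OF At]] by blast
  have ncA: "\<not> collin B M A" "\<not> collin M A B"
    using not_collinI[of ?t B M A] t BM At collin_rotate by blast+
  have Dt: "D \<notin> ?t" using opp unfolding opposite_def by blast
  have ncD: "\<not> collin B D M" using not_collinI[of ?t B M D] t BM Dt collin_rotate collin_swap by blast
  have "line Q M = ?a" "line M A = ?a" using line_eqI a d by blast+
  then have "parallel (line M A) (line B D)" using p1 by simp
  then have ang: "acong (angle B M A) (angle M B D)"
    using parallel_alternate_angles[OF ncA(1) opp] by blast
  have "scong {M, A} {Q, M}"
    using M scong_sym segmentI d unfolding midpoint_def by blast
  then have "scong {M, A} {B, D}"
    using p1(2) scong_trans segmentI d BM by blast
  moreover have "scong {M, B} {B, M}" using C2_refl segmentI BM by (metis insert_commute)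
  moreover have "acong (angle A M B) (angle D B M)" using ang angle_commute by metis
  ultimately have "acong (angle M B A) (angle B M D)"
    using C6[OF ncA(2) ncD] by blast
  moreover have "\<not> collin M B A" using ncA collin_swap by blast
  moreover have "opposite (line M B) A D" using opp line_commute by metis
  ultimately have "parallel (line B A) (line M D)" using alternate_angles_parallel by blast
  moreover have "line M D = line M N"
    using line_eqI[of M D "line M N"] line_props[OF MN] btw_in_line(1)[OF bD] dD by blast
  ultimately show ?thesis using parallel_sym line_commute by metis
qed

text \<open>
  The reflection \<open>D\<close> of \<open>A\<close> in \<open>M'\<close> lies on \<open>CC'\<close>, because the reflection sends the line
  \<open>AA'\<close> to a parallel through \<open>C'\<close>. Thus \<open>MM'\<close> is a midline of the triangle \<open>ACD\<close>.
  The legs \<open>AC\<close> and \<open>A'C'\<close> may cross each other.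
\<close>

lemma trapezoid_midline:
  assumes l: "l \<in> lines" "A \<in> l" "C \<in> l" and n: "n \<in> lines" "A' \<in> n" "C' \<in> n"
    and M: "midpoint M A C" and M': "midpoint M' A' C'"
    and off: "A \<notin> n" "C \<notin> n" "M' \<notin> l" and par: "parallel (line A A') (line C C')"
  shows "parallel (line M M') (line C C')"
proof -
  have b: "btw A M C" "btw A' M' C'" using M M' unfolding midpoint_def by auto
  note d = btw_distinct[OF b(1)] btw_distinct[OF b(2)]
  have M'n: "M' \<in> n" using btw_in_line(2)[OF b(2)] n by blast
  have "M' \<noteq> A" using off l by blast
  then obtain D where D: "midpoint M' A D" using exists_reflected_point by metis
  then have bD: "btw A M' D" unfolding midpoint_def by blast
  have Dn: "D \<notin> n" using btw_in_line(3)[OF bD n(1) M'n] off by blast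
  have Dl: "D \<notin> l" using btw_in_line(2)[OF bD] l off by blast
  have CC': "C \<noteq> C'" "D \<noteq> C'" "C \<noteq> D" using off n Dn Dl l by auto
  have "\<not> collin M' A' A" using not_collinI[of n M' A' A] n M'n off d by blast
  then have "parallel (line A' A) (line C' D)" using point_reflection M' D by blast
  then have "parallel (line C' D) (line C C')"
    using par parallel_sym parallel_trans line_commute by metis
  moreover have "C' \<in> line C' D" "C' \<in> line C C'" using CC' line_props by auto
  ultimately have "line C' D = line C C'" unfolding parallel_def by blast
  then have eq: "line C D = line C C'"
    using line_eqI[of C D "line C C'"] CC' line_props[of C C'] line_props[of C' D] by auto
  have "\<not> collin A C D" using not_collinI l d Dl by blast
  then show ?thesis using triangle_midline M D eq by metis
qed

end

section \<open>Additive functions of constant sign\<close>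

text \<open>
  Such a function is monotone and has the expected values at integers. Enclosing \<open>n * x\<close> between
  consecutive integers bounds \<open>n\<close> times the deviation from linearity at \<open>x\<close> by \<open>g 1\<close>, for
  every \<open>n\<close>; so the deviation vanishes.
\<close>

lemma additive_nonneg_imp_linear:
  fixes g :: "real \<Rightarrow> real"
  assumes add: "\<And>x y. g (x + y) = g x + g y" and nonneg: "\<And>x. x > 0 \<Longrightarrow> g x \<ge> 0"
  shows "g x = g 1 * x"
proof -
  have g0: "g 0 = 0" using add[of 0 0] by simp
  have neg: "g (- x) = - g x" for x using add[of x "- x"] g0 by simp
  have mono: "g x \<le> g y" if "x \<le> y" for x y
    using add[of x "y - x"] nonneg[of "y - x"] that by (cases "x = y") auto
  have nat: "g (of_nat n * x) = of_nat n * g x" for n x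
    by (induction n) (simp_all add: g0 add algebra_simps)
  have int: "g (of_int m) = of_int m * g 1" for m
  proof (cases m rule: int_cases2)
    case (nonneg n)
    then show ?thesis using nat[of n 1] by simp
  next
    case (nonpos n)
    then show ?thesis using nat[of n 1] neg[of "of_nat n"] by simp
  qed
  have bound: "of_nat n * \<bar>g x - g 1 * x\<bar> \<le> g 1" for n
  proof -
    define y where "y = of_nat n * x"
    have y: "of_int \<lfloor>y\<rfloor> \<le> y" "y \<le> of_int (\<lfloor>y\<rfloor> + 1)" by linarith+
    have g: "of_int \<lfloor>y\<rfloor> * g 1 \<le> g y" "g y \<le> of_int (\<lfloor>y\<rfloor> + 1) * g 1"
      using mono[OF y(1)] mono[OF y(2)] by (simp_all only: int)
    have "g 1 \<ge> 0" using nonneg by simp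
    then have "of_int \<lfloor>y\<rfloor> * g 1 \<le> y * g 1" "y * g 1 \<le> of_int (\<lfloor>y\<rfloor> + 1) * g 1"
      using y by (auto intro: mult_right_mono)
    then have "\<bar>g y - y * g 1\<bar> \<le> g 1" using g by (simp add: algebra_simps abs_le_iff)
    moreover have "g y - y * g 1 = of_nat n * (g x - g 1 * x)"
      unfolding y_def nat by (simp add: algebra_simps)
    ultimately show ?thesis by (simp add: abs_mult)
  qed
  show ?thesis
  proof (rule ccontr)
    assume "g x \<noteq> g 1 * x"
    then have "\<bar>g x - g 1 * x\<bar> > 0" by simp
    then obtain n :: nat where "g 1 < of_nat n * \<bar>g x - g 1 * x\<bar>"
      using reals_Archimedean3 by blast
    then show False using bound[of n] by simp
  qed
qed

section \<open>Parallel projection between the axes\<close>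

sublocale euclidean_plane_with_axes \<subseteq> nondegenerate_plane
  using x_scale unfolding real_scale_def by unfold_locales blast

context euclidean_plane_with_axes
begin

lemma axis_lines: "x_axis \<in> lines" "y_axis \<in> lines"
  using x_scale y_scale unfolding real_scale_def by auto

lemma on_axes [simp]: "px a \<in> x_axis" "py a \<in> y_axis"
  using x_scale y_scale unfolding real_scale_def bij_betw_def by auto

lemma px_eq_iff [simp]: "px a = px b \<longleftrightarrow> a = b"
  using x_scale unfolding real_scale_def bij_betw_def by (auto dest: injD)

lemma py_eq_iff [simp]: "py a = py b \<longleftrightarrow> a = b"
  using y_scale unfolding real_scale_def bij_betw_def by (auto dest: injD)

lemma axes_distinct: "x_axis \<noteq> y_axis"
  using axes_perpendicular unfolding perpendicular_def by blast

lemma axes_meet: "Q \<in> x_axis \<Longrightarrow> Q \<in> y_axis \<Longrightarrow> Q = px 0"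
  using line_unique[OF axis_lines, of Q "px 0"] axes_distinct on_axes common_origin by metis

lemma py_on_x_axis [simp]: "py a \<in> x_axis \<longleftrightarrow> a = 0"
  using axes_meet[of "py a"] common_origin py_eq_iff on_axes by metis

lemma px_on_y_axis [simp]: "px a \<in> y_axis \<longleftrightarrow> a = 0"
  using axes_meet[of "px a"] common_origin px_eq_iff on_axes by metis

lemma real_scale_midpoint:
  assumes "real_scale s l" "a \<noteq> c" shows "midpoint (s ((a + c) / 2)) (s a) (s c)"
proof -
  let ?m = "(a + c) / 2"
  have "a \<noteq> ?m" "?m \<noteq> c" "\<bar>a - ?m\<bar> = \<bar>?m - c\<bar>" "a < ?m \<and> ?m < c \<or> c < ?m \<and> ?m < a"
    using assms(2) by (auto simp: field_simps abs_if)
  then show ?thesis using assms(1) unfolding real_scale_def midpoint_def by blast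
qed

abbreviation direction :: "real \<Rightarrow> 'p set" where
  "direction b \<equiv> line (px b) (py 1)"

lemma px_neq_py1: "px b \<noteq> py 1"
  using py_on_x_axis[of 1] on_axes(1)[of b] by force

lemmas direction_props = line_props[OF px_neq_py1]

lemma direction_not_parallel_x_axis: "\<not> parallel x_axis (direction b)"
proof
  assume "parallel x_axis (direction b)"
  then have "x_axis = direction b"
    using on_axes(1)[of b] direction_props(2)[of b] unfolding parallel_def by blast
  then have "py 1 \<in> x_axis" using direction_props(3)[of b] by metis
  then show False by simp
qed

lemma direction_not_parallel_y_axis: "b \<noteq> 0 \<Longrightarrow> \<not> parallel y_axis (direction b)"
proof
  assume b: "b \<noteq> 0" and "parallel y_axis (direction b)"
  then have "y_axis = direction b"
    using on_axes(2)[of 1] direction_props(3)[of b] unfolding parallel_def by blast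
  then have "px b \<in> y_axis" using direction_props(2)[of b] by metis
  then show False using b by simp
qed

text \<open>
  This characterization replaces the two definite descriptions in \<^const>\<open>geo_mult\<close>: the parallel
  through \<open>py a\<close> is unique by the parallel axiom, and its intercept is unique because it is not
  the \<open>x\<close>-axis.
\<close>

lemma geo_mult_eqI:
  assumes m: "parallel m (direction b)" "py a \<in> m" "px x \<in> m"
  shows "geo_mult a b = x"
proof -
  have "parallel_through (py a) (direction b) = m"
    unfolding parallel_through_def
  proof (rule the_equality)
    show "py a \<in> m \<and> parallel m (direction b)" using m by blast
    show "m' = m" if "py a \<in> m' \<and> parallel m' (direction b)" for m'
      using P[OF direction_props(1)] that m by blast
  qed
  moreover have "x_intercept m = x"
    unfolding x_intercept_def
  proof (rule the_equality)
    show "px x \<in> m" using m by blast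
    show "c = x" if c: "px c \<in> m" for c
    proof (rule ccontr)
      assume "c \<noteq> x"
      moreover have "m \<in> lines" using m(1) unfolding parallel_def by blast
      ultimately have "m = x_axis"
        using line_unique[of m x_axis "px c" "px x"] axis_lines m(3) c by simp
      then show False using m(1) direction_not_parallel_x_axis by blast
    qed
  qed
  ultimately show ?thesis unfolding geo_mult_def by simp
qed

lemma geo_mult_line:
  obtains m where "parallel m (direction b)" "py a \<in> m" "px (geo_mult a b) \<in> m"
proof -
  obtain m where m: "parallel m (direction b)" "py a \<in> m"
    using exists_parallel[OF direction_props(1)] by blast
  have "m \<inter> x_axis \<noteq> {}"
  proof
    assume "m \<inter> x_axis = {}"
    then have "parallel x_axis m"
      using m axis_lines unfolding parallel_def by blast
    then show False using parallel_trans m(1) direction_not_parallel_x_axis by blast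
  qed
  then obtain x where "px x \<in> m"
    using x_scale unfolding real_scale_def bij_betw_def by blast
  then show ?thesis using that m geo_mult_eqI by metis
qed

lemma geo_mult_0_left: "geo_mult 0 b = 0"
proof -
  obtain m where "parallel m (direction b)" "py 0 \<in> m"
    using exists_parallel[OF direction_props(1)] by blast
  then show ?thesis using geo_mult_eqI common_origin by metis
qed

lemma geo_mult_1_left: "geo_mult 1 b = b"
  using geo_mult_eqI[of "direction b"] direction_props unfolding parallel_def by blast

lemma geo_mult_0_right: "geo_mult a 0 = 0"
proof -
  have "direction 0 = y_axis" using line_eqI[OF px_neq_py1] axis_lines by simp
  then show ?thesis using geo_mult_eqI[of y_axis] axis_lines unfolding parallel_def by simp
qed

lemma geo_mult_cancel_right:
  assumes b: "b \<noteq> 0" and eq: "geo_mult a b = geo_mult c b" shows "a = c"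
proof (rule ccontr)
  assume ac: "a \<noteq> c"
  obtain m where m: "parallel m (direction b)" "py a \<in> m" "px (geo_mult a b) \<in> m"
    by (rule geo_mult_line)
  obtain m' where m': "parallel m' (direction b)" "py c \<in> m'" "px (geo_mult c b) \<in> m'"
    by (rule geo_mult_line)
  have "m = m'" using P[OF direction_props(1) m(1) m'(1) m(3)] m'(3) eq by simp
  moreover have "m \<in> lines" using m(1) unfolding parallel_def by blast
  ultimately have "m = y_axis"
    using line_unique[of m y_axis "py a" "py c"] axis_lines m(2) m'(2) ac by simp
  then show False using m(1) direction_not_parallel_y_axis b by blast
qed

lemma geo_mult_nonzero: "\<lbrakk>a \<noteq> 0; b \<noteq> 0\<rbrakk> \<Longrightarrow> geo_mult a b \<noteq> 0"
  using geo_mult_cancel_right[of b a 0] geo_mult_0_left by metis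

lemma py_neq_px: "a \<noteq> 0 \<Longrightarrow> py a \<noteq> px x"
  using on_axes(1)[of x] py_on_x_axis[of a] by metis

lemma geo_mult_parallel:
  assumes "a \<noteq> 0"
  shows "parallel (line (py a) (px (geo_mult a b))) (direction b)"
proof -
  obtain m where m: "parallel m (direction b)" "py a \<in> m" "px (geo_mult a b) \<in> m"
    by (rule geo_mult_line)
  then have "line (py a) (px (geo_mult a b)) = m"
    using line_eqI[OF py_neq_px[OF assms]] unfolding parallel_def by blast
  then show ?thesis using m by simp
qed

lemma geo_mult_eq_parallelI:
  assumes "a \<noteq> 0" "parallel (line (py a) (px x)) (direction b)"
  shows "geo_mult a b = x"
  using geo_mult_eqI[OF assms(2)] line_props[OF py_neq_px[OF assms(1)]] by blast

lemma axes_triangle: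
  assumes "a \<noteq> 0" "x \<noteq> 0" shows "\<not> collin (px 0) (py a) (px x)"
  using not_collinI[of y_axis "px 0" "py a" "px x"] py_neq_px[of a 0] axis_lines assms by simp

lemma geo_mult_minus_left:
  assumes "a \<noteq> 0" "b \<noteq> 0" shows "geo_mult (- a) b = - geo_mult a b"
proof -
  let ?x = "geo_mult a b"
  have x: "?x \<noteq> 0" using geo_mult_nonzero assms by blast
  have "midpoint (px 0) (py a) (py (- a))" "midpoint (px 0) (px ?x) (px (- ?x))"
    using real_scale_midpoint[OF y_scale, of a "- a"] real_scale_midpoint[OF x_scale, of ?x "- ?x"]
      assms x common_origin by auto
  then have "parallel (line (py a) (px ?x)) (line (py (- a)) (px (- ?x)))"
    using point_reflection(1) axes_triangle[OF assms(1) x] by blast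
  then have "parallel (line (py (- a)) (px (- ?x))) (direction b)"
    using parallel_trans parallel_sym geo_mult_parallel[OF assms(1)] by blast
  then show ?thesis using geo_mult_eq_parallelI[of "- a"] assms by simp
qed

lemma geo_mult_half:
  assumes "a \<noteq> 0" "b \<noteq> 0" shows "geo_mult (a / 2) b = geo_mult a b / 2"
proof -
  let ?x = "geo_mult a b"
  have x: "?x \<noteq> 0" using geo_mult_nonzero assms by blast
  have "midpoint (py (a / 2)) (px 0) (py a)" "midpoint (px (?x / 2)) (px 0) (px ?x)"
    using real_scale_midpoint[OF y_scale, of 0 a] real_scale_midpoint[OF x_scale, of 0 ?x]
      assms x common_origin by auto
  then have "parallel (line (py (a / 2)) (px (?x / 2))) (line (py a) (px ?x))"
    using triangle_midline axes_triangle[OF assms(1) x] by blast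
  then have "parallel (line (py (a / 2)) (px (?x / 2))) (direction b)"
    using parallel_trans geo_mult_parallel[OF assms(1)] by blast
  then show ?thesis using geo_mult_eq_parallelI[of "a / 2"] assms by simp
qed

text \<open>
  The hypotheses exclude that the two projecting lines coincide or that one of them or the midline
  passes through the origin. For the midline, the midpoint of the images must differ from the
  origin as well, which holds since the projection is injective and odd.
\<close>

lemma geo_mult_midpoint:
  assumes "a \<noteq> 0" "c \<noteq> 0" "a \<noteq> c" "a + c \<noteq> 0" "b \<noteq> 0"
  shows "geo_mult ((a + c) / 2) b = (geo_mult a b + geo_mult c b) / 2"
proof -
  let ?x = "geo_mult a b" and ?z = "geo_mult c b"
  have xz: "?x \<noteq> ?z" using geo_mult_cancel_right assms by blast
  have "?x \<noteq> - ?z"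
    using geo_mult_cancel_right[of b a "- c"] geo_mult_minus_left[of c b] assms by auto
  then have s: "(?x + ?z) / 2 \<noteq> 0" by simp
  have par: "parallel (line (py a) (px ?x)) (line (py c) (px ?z))"
    using parallel_trans parallel_sym geo_mult_parallel assms by blast
  have "parallel (line (py ((a + c) / 2)) (px ((?x + ?z) / 2))) (line (py c) (px ?z))"
    by (rule trapezoid_midline[OF axis_lines(2) _ _ axis_lines(1) _ _
          real_scale_midpoint[OF y_scale assms(3)] real_scale_midpoint[OF x_scale xz] _ _ _ par])
      (use assms s in simp_all)
  then have "parallel (line (py ((a + c) / 2)) (px ((?x + ?z) / 2))) (direction b)"
    using parallel_trans geo_mult_parallel assms by blast
  then show ?thesis using geo_mult_eq_parallelI[of "(a + c) / 2"] assms by simp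
qed

text \<open>
  Since halving is preserved, additivity says that the midpoint of \<open>a\<close> and \<open>c\<close> goes to the midpoint
  of the images; the exceptional cases are those where the trapezoid degenerates.
\<close>

lemma geo_mult_add_left:
  assumes "b \<noteq> 0" shows "geo_mult (a + c) b = geo_mult a b + geo_mult c b"
proof -
  consider "a = 0 \<or> c = 0" | "a \<noteq> 0" "c = - a" | "a \<noteq> 0" "c = a"
    | "a \<noteq> 0" "c \<noteq> 0" "a \<noteq> c" "a + c \<noteq> 0" by fastforce
  then show ?thesis
  proof cases
    case 1
    then show ?thesis using geo_mult_0_left by auto
  next
    case 2
    then show ?thesis using geo_mult_0_left geo_mult_minus_left assms by simp
  next
    case 3
    then show ?thesis using geo_mult_half[of "a + a" b] assms by simp
  next
    case 4
    then show ?thesis using geo_mult_half[of "a + c" b] geo_mult_midpoint assms by simp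
  qed
qed

text \<open>
  The projecting line through \<open>py a\<close> separates \<open>px 0\<close> from \<open>py c\<close>, and the parallel projecting line
  keeps \<open>py c\<close> and its image on one side of it.
\<close>

lemma geo_mult_btw:
  assumes a: "0 < a" "a < c" and b: "b \<noteq> 0"
  shows "btw (px 0) (px (geo_mult a b)) (px (geo_mult c b))"
proof -
  let ?x = "geo_mult a b" and ?z = "geo_mult c b"
  let ?l = "line (py a) (px ?x)" and ?n = "line (py c) (px ?z)"
  have a0: "a \<noteq> 0" "c \<noteq> 0" using a by auto
  have x0: "?x \<noteq> 0" "?z \<noteq> 0" using geo_mult_nonzero a0 b by auto
  have l: "?l \<in> lines" "py a \<in> ?l" "px ?x \<in> ?l" using line_props[OF py_neq_px] a0 by auto
  have n: "py c \<in> ?n" "px ?z \<in> ?n" using line_props[OF py_neq_px] a0 by auto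
  have off: "py e \<notin> ?l" if "e \<noteq> a" for e
    using line_unique[of ?l y_axis "py a" "py e"] l axis_lines that x0 px_on_y_axis[of ?x] by auto
  have b1: "btw (px 0) (py a) (py c)"
    using y_scale a common_origin unfolding real_scale_def by metis
  have O: "px 0 \<notin> ?l" using off[of 0] a0 common_origin by simp
  have "parallel ?l ?n" using parallel_trans parallel_sym geo_mult_parallel a0 by blast
  moreover have "?l \<noteq> ?n" using off[of c] n a by auto
  ultimately have "same_side ?l (py c) (px ?z)" using parallel_same_side n by blast
  then have "opposite ?l (px 0) (px ?z)"
    using opposite_transfer[OF l(1) same_side_refl[OF O]] opposite_through[OF l(1) O l(2) b1] by blast
  then show ?thesis
    by (rule opposite_meet[OF _ l(1) axis_lines(1) on_axes(1) on_axes(1) l(3) on_axes(1)])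
qed

text \<open>
  The image of \<open>1\<close> is \<open>b\<close>, and betweenness puts the image of every other positive real on the
  same side of the origin.
\<close>

lemma geo_mult_sign:
  assumes "0 < a" "b \<noteq> 0" shows "geo_mult a b / b > 0"
proof -
  have btw_px: "0 < u \<and> u < v \<or> v < u \<and> u < 0" if "btw (px 0) (px u) (px v)" for u v
    using x_scale that unfolding real_scale_def by blast
  consider "a < 1" | "a = 1" | "a > 1" by linarith
  then show ?thesis
  proof cases
    case 1
    then have "btw (px 0) (px (geo_mult a b)) (px b)"
      using geo_mult_btw[of a 1 b] geo_mult_1_left assms by simp
    from btw_px[OF this] show ?thesis by (auto simp: zero_less_divide_iff)
  next
    case 2
    then show ?thesis using geo_mult_1_left assms by simp
  next
    case 3
    then have "btw (px 0) (px b) (px (geo_mult a b))"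
      using geo_mult_btw[of 1 a b] geo_mult_1_left assms by simp
    from btw_px[OF this] show ?thesis by (auto simp: zero_less_divide_iff)
  qed
qed

text \<open>
  Dividing by \<open>b\<close> makes the projection nonnegative on the positive reals whatever the sign of \<open>b\<close>.
\<close>

theorem geo_mult_eq_times: "geo_mult a b = a * b"
proof (cases "b = 0")
  case True
  then show ?thesis using geo_mult_0_right by simp
next
  case False
  have "geo_mult a b / b = geo_mult 1 b / b * a"
  proof (rule additive_nonneg_imp_linear)
    show "geo_mult (x + y) b / b = geo_mult x b / b + geo_mult y b / b" for x y
      using geo_mult_add_left[OF False] by (simp add: add_divide_distrib)
    show "0 \<le> geo_mult x b / b" if "0 < x" for x
      using geo_mult_sign[OF that False] by simp
  qed
  then show ?thesis using False geo_mult_1_left by (simp add: field_simps)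
qed

end

theorem theorem7:
  fixes lines :: "'p set set"
    and btw :: "'p \<Rightarrow> 'p \<Rightarrow> 'p \<Rightarrow> bool"
    and scong :: "'p set \<Rightarrow> 'p set \<Rightarrow> bool"
    and acong :: "'p set set \<Rightarrow> 'p set set \<Rightarrow> bool"
    and px py :: "real \<Rightarrow> 'p"
    and x_axis y_axis :: "'p set"
    and a b :: real
  assumes "euclidean_plane_with_axes lines btw scong acong px py x_axis y_axis"
  shows "euclidean_plane_with_axes.geo_mult lines px py a b =
    euclidean_plane_with_axes.geo_mult lines px py b a"
proof -
  interpret euclidean_plane_with_axes lines btw scong acong px py x_axis y_axis by (rule assms)
  show ?thesis by (simp add: geo_mult_eq_times mult.commute)
qed

end
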